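(* Let $q$ be a prime power, $m\ge1$, $1\le k\le q-1$, $v=k+(m-1)(q-1)$, $n=|\mathbb P^m|=\frac{q^{m+1}-1}{q-1}$ and $d=\gcd(n,q-1)$. Let $\phi:\mathbb F_{q^{m+1}}\to\mathbb F_q^{m+1}$ be an isomorphism of $\mathbb F_q$-vector spaces, $\omega$ a primitive element of $\mathbb F_{q^{m+1}}$, and let $U$, $U_0,\dots,U_{d-1}$, $w$ and $\psi$ be as defined in the context. If $n/d$ and $q-1$ are coprime, then the code $\mathcal C'=w^v\star\mathrm{PLift}_q(m,k)$ (with coordinates indexed by $U$) is quasi-cyclic of index $d$, through the permutation $\psi^d\in\mathfrak S(U)$, and the orbits of $\psi^d$ on $U$ are the subsets $U_i$, $0\le i<d$.
   Context: Lifted code. $\mathbb P^m=(\mathbb F_q^{m+1}\setminus\{0\})/\mathbb F_q^\times$; the standard representative of a point is the one whose leftmost non-zero coordinate is $1$. $\mathbb F_q[\mathbf X]^H_v$ is the space of homogeneous polynomials of degree $v$ in $X_0,\dots,X_m$ (together with $0$), and $\mathrm{ev}_{\mathbb P^m}(f)=(f(\mathbf P))_{\mathbf P\in\mathbb P^m}$, evaluating at standard representatives. $\mathrm{PRS}_q(k)=\{\mathrm{ev}_{\mathbb P^1}(g): g\in\mathbb F_q[S,T]^H_k\}$. $\mathrm{Emb}_{\mathbb P}(m)$ is the set of injective $\mathbb F_q$-linear maps $L:\mathbb F_q^2\to\mathbb F_q^{m+1}$, and $f\circ L=f(L(S,T))$. For $v=k+(m-1)(q-1)$, $$\mathrm{PLift}_q(m,k)=\{\mathrm{ev}_{\mathbb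 P^m}(f): f\in\mathbb F_q[\mathbf X]^H_v,\ \forall L\in\mathrm{Emb}_{\mathbb P}(m),\ \mathrm{ev}_{\mathbb P^1}(f\circ L)\in\mathrm{PRS}_q(k)\}.$$ Set $\beta=\omega^{q-1}$. For $0\le i<d$ let $U_i=(\phi(\omega^i\beta^{d}),\phi(\omega^i\beta^{2d}),\dots,\phi(\omega^i\beta^{(n/d)d}))$, and let $U$ be the concatenation of $U_0,\dots,U_{d-1}$. When $n/d$ and $q-1$ are coprime, the $n$ vectors in $U$ are representatives of the $n$ points of $\mathbb P^m$, each point being represented exactly once. For $\mathbf u\in U$ let $\mathbf P_{\mathbf u}$ be the standard representative of the point defined by $\mathbf u$, and $w_{\mathbf u}\in\mathbb F_q^\times$ the scalar with $\mathbf u=w_{\mathbf u}\mathbf P_{\mathbf u}$. Then $w^v\star\mathrm{PLift}_q(m,k)=\{(w_{\mathbf u}^v\,c_{\mathbf P_{\mathbf u}})_{\mathbf u\in U}: c\in\mathrm{PLift}_q(m,k)\}\subseteq\mathbb F_q^U$. The map $\psi\in\mathrm{GL}_{m+1}(\mathbb F_q)$ is $\psi(\mathbf x)=\phi(\beta\,\phi^{-1}(\mathbf x))$, and $\psi^d$ is its $d$-fold composition. A permutation $\sigma$ of a finite set $X$ acts on $\mathbb F_q^X$ by $\sigma(c)=(c_{\sigma^{-1}(x)})_{x\in X}$; $\mathrm{Perm}(\mathcal C)$ is the group of permutations of $X$ leaving $\mathcal C\subseteq\mathbb F_q^X$ invariant. With $|X|=n$, $\mathcal C$ is quasi-cyclic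 of index $c$ (through $\sigma$) if $\sigma\in\mathrm{Perm}(\mathcal C)$ is a product of $c$ different $(n/c)$-cycles with disjoint orbits. *)

theory Defs
  imports
    "Jordan_Normal_Form.Matrix"
    "HOL-Library.Poly_Mapping"
    "HOL-Library.Cardinality"
    "HOL-Library.FuncSet"
    "HOL-Combinatorics.Cycles"
    "HOL-Combinatorics.Orbits"
begin

text \<open>Coordinates \<open>X\<^sub>0, \<dots>, X\<^sub>m\<close> are the entries \<open>0, \<dots>, m\<close> of vectors in \<open>carrier_vec (m + 1)\<close>.
  Points are the classes of nonzero vectors, i.e. sets of vectors.\<close>

definition proj_rel :: "nat \<Rightarrow> ('a::field vec \<times> 'a vec) set" where
  "proj_rel m = {(x, y). x \<in> carrier_vec (m + 1) - {0\<^sub>v (m + 1)} \<and>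
     y \<in> carrier_vec (m + 1) - {0\<^sub>v (m + 1)} \<and> (\<exists>a. a \<noteq> 0 \<and> y = a \<cdot>\<^sub>v x)}"

definition proj_space :: "nat \<Rightarrow> 'a::field vec set set" where
  "proj_space m = (carrier_vec (m + 1) - {0\<^sub>v (m + 1)}) // proj_rel m"

definition proj_point :: "nat \<Rightarrow> 'a::field vec \<Rightarrow> 'a vec set" where
  "proj_point m u = proj_rel m `` {u}"

definition standard_vec :: "'a::field vec \<Rightarrow> bool" where
  "standard_vec x \<longleftrightarrow> (\<exists>i<dim_vec x. x $ i = 1 \<and> (\<forall>j<i. x $ j = 0))"

definition std_rep :: "'a::field vec set \<Rightarrow> 'a vec" where
  "std_rep P = (THE x. x \<in> P \<and> standard_vec x)"

definition proj_weight :: "nat \<Rightarrow> 'a::field vec \<Rightarrow> 'a" where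
  "proj_weight m u = (THE w. w \<noteq> 0 \<and> u = w \<cdot>\<^sub>v std_rep (proj_point m u))"

text \<open>A polynomial is a finitely supported map from monomials to coefficients, a monomial being a
  finitely supported map from variable indices to exponents; multiplication is convolution.\<close>

type_synonym 'a mpol = "(nat \<Rightarrow>\<^sub>0 nat) \<Rightarrow>\<^sub>0 'a"

definition mp_const :: "'a::comm_ring_1 \<Rightarrow> 'a mpol" where
  "mp_const c = Poly_Mapping.single 0 c"

definition mp_var :: "nat \<Rightarrow> 'a::comm_ring_1 mpol" where
  "mp_var i = Poly_Mapping.single (Poly_Mapping.single i 1) 1"

definition mp_subst :: "('a::comm_ring_1 \<Rightarrow> 'b::comm_ring_1) \<Rightarrow> (nat \<Rightarrow> 'b) \<Rightarrow> 'a mpol \<Rightarrow> 'b" where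
  "mp_subst h x f = (\<Sum>t\<in>Poly_Mapping.keys f. h (Poly_Mapping.lookup f t) *
     (\<Prod>i\<in>Poly_Mapping.keys t. x i ^ Poly_Mapping.lookup t i))"

definition mp_eval :: "'a::comm_ring_1 mpol \<Rightarrow> 'a vec \<Rightarrow> 'a" where
  "mp_eval f x = mp_subst id (\<lambda>i. x $ i) f"

definition hom_polys :: "nat \<Rightarrow> nat \<Rightarrow> 'a::comm_ring_1 mpol set" where
  "hom_polys m v = {f. \<forall>t\<in>Poly_Mapping.keys f.
     Poly_Mapping.keys t \<subseteq> {..m} \<and> (\<Sum>i\<in>Poly_Mapping.keys t. Poly_Mapping.lookup t i) = v}"

definition linear_vec_map :: "nat \<Rightarrow> nat \<Rightarrow> ('a::field vec \<Rightarrow> 'a vec) \<Rightarrow> bool" where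
  "linear_vec_map a b L \<longleftrightarrow> L \<in> carrier_vec a \<rightarrow> carrier_vec b \<and>
     (\<forall>x\<in>carrier_vec a. \<forall>y\<in>carrier_vec a. L (x + y) = L x + L y) \<and>
     (\<forall>c. \<forall>x\<in>carrier_vec a. L (c \<cdot>\<^sub>v x) = c \<cdot>\<^sub>v L x)"

definition Emb_proj :: "nat \<Rightarrow> ('a::field vec \<Rightarrow> 'a vec) set" where
  "Emb_proj m = {L. linear_vec_map 2 (m + 1) L \<and> inj_on L (carrier_vec 2)}"

text \<open>The variables \<open>S\<close>, \<open>T\<close> are \<open>mp_var 0\<close>, \<open>mp_var 1\<close>, and the \<open>i\<close>-th entry of \<open>L(S, T)\<close> is the
  linear form \<open>L(1, 0)\<^sub>i S + L(0, 1)\<^sub>i T\<close>.\<close>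

definition mp_comp :: "'a::field mpol \<Rightarrow> ('a vec \<Rightarrow> 'a vec) \<Rightarrow> 'a mpol" where
  "mp_comp f L = mp_subst mp_const
     (\<lambda>i. mp_const (L (unit_vec 2 0) $ i) * mp_var 0 + mp_const (L (unit_vec 2 1) $ i) * mp_var 1) f"

text \<open>A code with coordinates indexed by a set \<open>X\<close> is a set of functions that are \<open>undefined\<close>
  outside \<open>X\<close>.\<close>

definition proj_ev :: "nat \<Rightarrow> 'a::field mpol \<Rightarrow> 'a vec set \<Rightarrow> 'a" where
  "proj_ev m f = (\<lambda>P\<in>proj_space m. mp_eval f (std_rep P))"

definition PRS :: "nat \<Rightarrow> ('a::{field,finite} vec set \<Rightarrow> 'a) set" where
  "PRS k = proj_ev 1 ` hom_polys 1 k"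

definition PLift :: "nat \<Rightarrow> nat \<Rightarrow> ('a::{field,finite} vec set \<Rightarrow> 'a) set" where
  "PLift m k = proj_ev m ` {f \<in> hom_polys m (k + (m - 1) * (CARD('a) - 1)).
     \<forall>L\<in>Emb_proj m. proj_ev 1 (mp_comp f L) \<in> PRS k}"

text \<open>Here \<open>X\<close> is a set of representatives of points.\<close>

definition weighted_code ::
    "nat \<Rightarrow> nat \<Rightarrow> 'a::field vec set \<Rightarrow> ('a vec set \<Rightarrow> 'a) set \<Rightarrow> ('a vec \<Rightarrow> 'a) set" where
  "weighted_code m v X C = (\<lambda>c. \<lambda>u\<in>X. proj_weight m u ^ v * c (proj_point m u)) ` C"

definition perm_act :: "'x set \<Rightarrow> ('x \<Rightarrow> 'x) \<Rightarrow> ('x \<Rightarrow> 'a) \<Rightarrow> 'x \<Rightarrow> 'a" where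
  "perm_act X \<sigma> c = (\<lambda>x\<in>X. c (inv_into UNIV \<sigma> x))"

definition Perm_code :: "'x set \<Rightarrow> ('x \<Rightarrow> 'a) set \<Rightarrow> ('x \<Rightarrow> 'x) set" where
  "Perm_code X C = {\<sigma>. \<sigma> permutes X \<and> perm_act X \<sigma> ` C = C}"

definition quasi_cyclic_through ::
    "'x set \<Rightarrow> ('x \<Rightarrow> 'a) set \<Rightarrow> nat \<Rightarrow> ('x \<Rightarrow> 'x) \<Rightarrow> bool" where
  "quasi_cyclic_through X C c \<sigma> \<longleftrightarrow> \<sigma> \<in> Perm_code X C \<and> c dvd card X \<and>
     (\<exists>css. length css = c \<and>
        (\<forall>cs\<in>set css. cycle cs \<and> length cs = card X div c \<and> set cs \<subseteq> X) \<and>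
        (\<forall>i<c. \<forall>j<c. i \<noteq> j \<longrightarrow> set (css ! i) \<inter> set (css ! j) = {}) \<and>
        \<sigma> = foldr (\<circ>) (map cycle_of_list css) id)"

definition primitive_element :: "'b::field \<Rightarrow> bool" where
  "primitive_element \<omega> \<longleftrightarrow> \<omega> \<noteq> 0 \<and> (\<forall>x. x \<noteq> 0 \<longrightarrow> (\<exists>i::nat. x = \<omega> ^ i))"

text \<open>The extension of fields is given by an embedding \<open>\<iota>\<close> of the small field into the large one.\<close>

definition vs_iso :: "('a::field \<Rightarrow> 'b::field) \<Rightarrow> nat \<Rightarrow> ('b \<Rightarrow> 'a vec) \<Rightarrow> bool" where
  "vs_iso \<iota> r \<phi> \<longleftrightarrow> bij_betw \<phi> UNIV (carrier_vec r) \<and>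
     (\<forall>x y. \<phi> (x + y) = \<phi> x + \<phi> y) \<and> (\<forall>a x. \<phi> (\<iota> a * x) = a \<cdot>\<^sub>v \<phi> x)"

definition coord_block :: "('b::field \<Rightarrow> 'a vec) \<Rightarrow> 'b \<Rightarrow> 'b \<Rightarrow> nat \<Rightarrow> nat \<Rightarrow> nat \<Rightarrow> 'a vec list" where
  "coord_block \<phi> \<omega> \<beta> n d i = map (\<lambda>j. \<phi> (\<omega> ^ i * \<beta> ^ (j * d))) [1..<n div d + 1]"

definition coord_list :: "('b::field \<Rightarrow> 'a vec) \<Rightarrow> 'b \<Rightarrow> 'b \<Rightarrow> nat \<Rightarrow> nat \<Rightarrow> 'a vec list" where
  "coord_list \<phi> \<omega> \<beta> n d = concat (map (coord_block \<phi> \<omega> \<beta> n d) [0..<d])"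

definition mult_map :: "('b::field \<Rightarrow> 'a vec) \<Rightarrow> 'b \<Rightarrow> 'a vec \<Rightarrow> 'a vec" where
  "mult_map \<phi> \<beta> x = \<phi> (\<beta> * inv_into UNIV \<phi> x)"

lemma card_carrier_vec_finite:
  "card (carrier_vec r :: 'a::finite vec set) = CARD('a) ^ r"
proof -
  have "bij_betw (\<lambda>x. \<lambda>i\<in>{..<r}. x $ i) (carrier_vec r :: 'a vec set) ({..<r} \<rightarrow>\<^sub>E UNIV)"
  proof (rule bij_betw_byWitness[where f' = "vec r"])
    show "\<forall>x\<in>carrier_vec r. vec r (\<lambda>i\<in>{..<r}. x $ i) = x"
      by (auto intro!: eq_vecI)
    show "\<forall>f\<in>{..<r} \<rightarrow>\<^sub>E UNIV. (\<lambda>i\<in>{..<r}. vec r f $ i) = f"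
      by (auto simp: fun_eq_iff PiE_def extensional_def restrict_def)
    show "(\<lambda>x. \<lambda>i\<in>{..<r}. x $ i) ` (carrier_vec r :: 'a vec set) \<subseteq> {..<r} \<rightarrow>\<^sub>E UNIV"
      by (rule image_subsetI) (rule restrict_PiE_iff[THEN iffD2], simp)
    show "vec r ` ({..<r} \<rightarrow>\<^sub>E UNIV) \<subseteq> (carrier_vec r :: 'a vec set)"
      by (rule image_subsetI) (rule vec_carrier)
  qed
  then have "card (carrier_vec r :: 'a vec set) = card ({..<r} \<rightarrow>\<^sub>E (UNIV :: 'a set))"
    by (rule bij_betw_same_card)
  also have "\<dots> = CARD('a) ^ r"
    by (simp only: card_PiE[OF finite_lessThan] prod_constant card_lessThan)
  finally show ?thesis .
qed

lemma equiv_proj_rel: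
  "equiv (carrier_vec (m + 1) - {0\<^sub>v (m + 1)}) (proj_rel m :: ('a::field vec \<times> 'a vec) set)"
proof (rule equivI)
  show "refl_on (carrier_vec (m + 1) - {0\<^sub>v (m + 1)}) (proj_rel m :: ('a vec \<times> 'a vec) set)"
    by (auto simp: refl_on_def proj_rel_def intro!: exI[of _ "1::'a"])
  show "sym (proj_rel m :: ('a vec \<times> 'a vec) set)"
  proof (rule symI)
    fix x y :: "'a vec" assume "(x, y) \<in> proj_rel m"
    then obtain a where a: "a \<noteq> 0" "y = a \<cdot>\<^sub>v x" and
      xy: "x \<in> carrier_vec (m + 1) - {0\<^sub>v (m + 1)}" "y \<in> carrier_vec (m + 1) - {0\<^sub>v (m + 1)}"
      by (auto simp: proj_rel_def)
    have "x = inverse a \<cdot>\<^sub>v y" using a by (simp add: smult_smult_assoc)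
    with a xy show "(y, x) \<in> proj_rel m"
      unfolding proj_rel_def by (auto intro!: exI[of _ "inverse a"])
  qed
  show "trans (proj_rel m :: ('a vec \<times> 'a vec) set)"
  proof (rule transI)
    fix x y z :: "'a vec" assume xy: "(x, y) \<in> proj_rel m" and yz: "(y, z) \<in> proj_rel m"
    then obtain a b where ab: "a \<noteq> 0" "y = a \<cdot>\<^sub>v x" "b \<noteq> 0" "z = b \<cdot>\<^sub>v y"
      unfolding proj_rel_def by blast
    then have "b * a \<noteq> 0 \<and> z = (b * a) \<cdot>\<^sub>v x" by (simp add: smult_smult_assoc)
    then have "\<exists>c. c \<noteq> 0 \<and> z = c \<cdot>\<^sub>v x" by (rule exI)
    moreover have "x \<in> carrier_vec (m + 1) - {0\<^sub>v (m + 1)}" "z \<in> carrier_vec (m + 1) - {0\<^sub>v (m + 1)}"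
      using xy yz by (simp_all add: proj_rel_def)
    ultimately show "(x, z) \<in> proj_rel m" by (simp add: proj_rel_def)
  qed
qed (auto simp: proj_rel_def)

lemma card_proj_space:
  "card (proj_space m :: 'a::{field,finite} vec set set) =
    (CARD('a) ^ (m + 1) - 1) div (CARD('a) - 1)"
proof -
  let ?V = "carrier_vec (m + 1) - {0\<^sub>v (m + 1)} :: 'a vec set"
  have fin: "finite (carrier_vec (m + 1) :: 'a vec set)"
    by (rule card_ge_0_finite) (simp add: card_carrier_vec_finite)
  have cardV: "card ?V = CARD('a) ^ (m + 1) - 1"
    using fin by (simp add: card_Diff_singleton card_carrier_vec_finite)
  have two: "CARD('a) \<ge> 2"
  proof -
    have "card {0, 1 :: 'a} \<le> CARD('a)" by (rule card_mono) auto
    then show ?thesis by simp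
  qed
  have cls: "card P = CARD('a) - 1" if P: "P \<in> proj_space m" for P :: "'a vec set"
  proof -
    from P obtain x where x: "x \<in> ?V" "P = proj_rel m `` {x}"
      by (auto simp: proj_space_def elim!: quotientE)
    obtain i where i: "i < m + 1" "x $ i \<noteq> 0"
      using x(1) by (metis Diff_iff carrier_vecD eq_vecI index_zero_vec singletonI)
    have dim: "dim_vec x = m + 1" using x(1) by auto
    have coord: "(a \<cdot>\<^sub>v x) $ i = a * x $ i" for a
      using i dim by simp
    have nz: "a \<cdot>\<^sub>v x \<noteq> 0\<^sub>v (m + 1)" if "a \<noteq> 0" for a
      using coord[of a] i that by (metis index_zero_vec(1) mult_eq_0_iff)
    have "P = (\<lambda>a. a \<cdot>\<^sub>v x) ` (UNIV - {0})"
      using x nz by (auto simp: proj_rel_def)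
    moreover have "inj_on (\<lambda>a. a \<cdot>\<^sub>v x) (UNIV - {0})"
      by (rule inj_onI) (metis coord i(2) mult_right_cancel)
    ultimately show ?thesis
      by (simp add: card_image card_Diff_singleton)
  qed
  have "card (\<Union> (proj_space m :: 'a vec set set)) = (\<Sum>P\<in>proj_space m. card (P :: 'a vec set))"
  proof (rule card_Union_disjoint)
    show "pairwise disjnt (proj_space m :: 'a vec set set)"
      using quotient_disj[OF equiv_proj_rel[of m, where 'a = 'a]]
      unfolding proj_space_def pairwise_def disjnt_def by blast
    show "finite P" if "P \<in> proj_space m" for P :: "'a vec set"
    proof (rule finite_subset[OF _ fin])
      have "P \<subseteq> \<Union> (proj_space m)" using that by blast
      also have "\<dots> = ?V"
        unfolding proj_space_def by (rule Union_quotient[OF equiv_proj_rel])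
      finally show "P \<subseteq> carrier_vec (m + 1)" by blast
    qed
  qed
  also have "\<dots> = card (proj_space m :: 'a vec set set) * (CARD('a) - 1)"
    by (simp add: cls)
  also have "\<Union> (proj_space m :: 'a vec set set) = ?V"
    unfolding proj_space_def by (rule Union_quotient[OF equiv_proj_rel])
  finally have "CARD('a) ^ (m + 1) - 1 = card (proj_space m :: 'a vec set set) * (CARD('a) - 1)"
    unfolding cardV by argo
  moreover have "CARD('a) - 1 \<noteq> 0" using two by linarith
  ultimately show ?thesis by (metis nonzero_mult_div_cancel_right)
qed

end

theory Submission
  imports Defs
begin

text \<open>Since a homogeneous \<open>f\<close> of degree \<open>v\<close> satisfies \<open>f (w \<cdot> P) = w\<^sup>v \<cdot> f P\<close>, the weighted code consists of
  the vectors of values of the lifted polynomials at the representatives \<open>u \<in> U\<close> themselves. A linear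
  automorphism \<open>A\<close> preserves the set of lifted polynomials under \<open>f \<mapsto> f \<circ> A\<close>, because
  \<open>L \<mapsto> A \<circ> L\<close> permutes the embeddings of the line; hence every permutation of \<open>U\<close> induced by an
  automorphism, such as \<open>\<psi>\<^sup>d\<close>, preserves the code. Up to the common factor \<open>\<beta>\<^sup>d\<close>, the entries of
  \<open>U\<close> are the images of \<open>\<omega>\<^sup>e\<close> with \<open>e = i + (q - 1) d j\<close>, \<open>i < d\<close>, \<open>j < n / d\<close>. These exponents
  are distinct and smaller than the order \<open>(q - 1) n\<close> of \<open>\<omega>\<close>, and \<open>\<psi>\<^sup>d\<close> increases \<open>j\<close> by \<open>1\<close>
  modulo \<open>n / d\<close>.\<close>

section \<open>Evaluation and substitution of polynomials\<close>

definition monom_val :: "(nat \<Rightarrow> 'a::comm_ring_1) \<Rightarrow> (nat \<Rightarrow>\<^sub>0 nat) \<Rightarrow> 'a" where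
  "monom_val x t = (\<Prod>i\<in>Poly_Mapping.keys t. x i ^ Poly_Mapping.lookup t i)"

text \<open>Indices outside the support contribute a factor with exponent 0. Monomials with
  different supports can thus be compared over one common index set.\<close>

lemma monom_val_superset:
  assumes "finite A" "Poly_Mapping.keys t \<subseteq> A"
  shows "monom_val x t = (\<Prod>i\<in>A. x i ^ Poly_Mapping.lookup t i)"
  unfolding monom_val_def
  by (rule prod.mono_neutral_left) (use assms in \<open>auto simp: in_keys_iff\<close>)

lemma monom_val_add: "monom_val x (s + t) = monom_val x s * monom_val x t"
proof -
  let ?A = "Poly_Mapping.keys s \<union> Poly_Mapping.keys t"
  have "monom_val x u = (\<Prod>i\<in>?A. x i ^ Poly_Mapping.lookup u i)" if "u \<in> {s, t, s + t}" for u
    by (rule monom_val_superset) (use that keys_add[of s t] in auto)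
  then show ?thesis
    by (simp add: lookup_add power_add prod.distrib)
qed

lemma mp_eval_superset:
  assumes "finite A" "Poly_Mapping.keys f \<subseteq> A"
  shows "mp_eval f x = (\<Sum>t\<in>A. Poly_Mapping.lookup f t * monom_val (($) x) t)"
  unfolding mp_eval_def mp_subst_def monom_val_def id_apply
  by (rule sum.mono_neutral_left) (use assms in \<open>auto simp: in_keys_iff\<close>)

lemma mp_eval_zero [simp]: "mp_eval 0 x = 0"
  by (simp add: mp_eval_def mp_subst_def)

lemma mp_eval_add: "mp_eval (f + g) x = mp_eval f x + mp_eval g x"
proof -
  let ?A = "Poly_Mapping.keys f \<union> Poly_Mapping.keys g"
  have "mp_eval h x = (\<Sum>t\<in>?A. Poly_Mapping.lookup h t * monom_val (($) x) t)"
    if "h \<in> {f, g, f + g}" for h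
    by (rule mp_eval_superset) (use that keys_add[of f g] in auto)
  then show ?thesis
    by (simp add: lookup_add distrib_right sum.distrib)
qed

lemma mp_eval_sum: "mp_eval (\<Sum>i\<in>A. F i) x = (\<Sum>i\<in>A. mp_eval (F i) x)"
  by (induction A rule: infinite_finite_induct) (simp_all add: mp_eval_add)

lemma mp_eval_single: "mp_eval (Poly_Mapping.single t c) x = c * monom_val (($) x) t"
  by (subst mp_eval_superset[of "{t}"]) (auto simp: lookup_single)

text \<open>Splitting a polynomial into its terms reduces multiplicativity of evaluation to products
  of two single terms.\<close>

lemma poly_mapping_eq_sum_single:
  "f = (\<Sum>t\<in>Poly_Mapping.keys f. Poly_Mapping.single t (Poly_Mapping.lookup f t))"
  by (rule poly_mapping_eqI)
    (simp add: lookup_sum lookup_single when_def in_keys_iff)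

lemma mp_eval_mult: "mp_eval (f * g) x = mp_eval f x * mp_eval g x"
proof -
  have "f * g = (\<Sum>s\<in>Poly_Mapping.keys f. \<Sum>t\<in>Poly_Mapping.keys g.
      Poly_Mapping.single (s + t) (Poly_Mapping.lookup f s * Poly_Mapping.lookup g t))"
    by (subst poly_mapping_eq_sum_single[of f], subst poly_mapping_eq_sum_single[of g])
      (simp add: sum_product mult_single)
  then have "mp_eval (f * g) x = (\<Sum>s\<in>Poly_Mapping.keys f. \<Sum>t\<in>Poly_Mapping.keys g.
      (Poly_Mapping.lookup f s * monom_val (($) x) s) *
      (Poly_Mapping.lookup g t * monom_val (($) x) t))"
    by (simp add: mp_eval_sum mp_eval_single monom_val_add mult_ac)
  then show ?thesis
    by (simp add: mp_eval_superset[OF finite_keys order_refl] sum_product)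
qed

lemma mp_eval_const [simp]: "mp_eval (mp_const c) x = c"
  by (simp add: mp_const_def mp_eval_single monom_val_def)

lemma mp_eval_var [simp]: "mp_eval (mp_var i) x = x $ i"
  by (simp add: mp_var_def mp_eval_single monom_val_def)

lemma mp_eval_one [simp]: "mp_eval 1 x = 1"
  using mp_eval_const[of 1 x] by (simp add: mp_const_def)

lemma mp_eval_power: "mp_eval (f ^ n) x = mp_eval f x ^ n"
  by (induction n) (simp_all add: mp_eval_mult)

lemma mp_eval_prod: "mp_eval (\<Prod>i\<in>A. F i) x = (\<Prod>i\<in>A. mp_eval (F i) x)"
  by (induction A rule: infinite_finite_induct) (simp_all add: mp_eval_mult)

text \<open>Evaluation at \<open>x\<close> is a ring homomorphism that fixes constants, so it passes
  through sums, products and powers down to the substituted polynomials.\<close>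

lemma mp_eval_subst: "mp_eval (mp_subst mp_const y f) x = mp_subst id (\<lambda>i. mp_eval (y i) x) f"
  by (simp add: mp_subst_def mp_eval_sum mp_eval_mult mp_eval_prod mp_eval_power)

section \<open>Homogeneous polynomials\<close>

lemma hom_polys_zero: "0 \<in> hom_polys m v"
  by (simp add: hom_polys_def)

lemma hom_polys_add:
  assumes "f \<in> hom_polys m v" "g \<in> hom_polys m v"
  shows "f + g \<in> hom_polys m v"
  using assms keys_add[of f g] unfolding hom_polys_def by blast

lemma hom_polys_sum:
  assumes "\<And>i. i \<in> A \<Longrightarrow> F i \<in> hom_polys m v"
  shows "(\<Sum>i\<in>A. F i) \<in> hom_polys m v"
  using assms
  by (induction A rule: infinite_finite_induct) (auto intro: hom_polys_zero hom_polys_add)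

text \<open>Over the fixed index set \<open>{..m}\<close> the degree of a monomial is visibly
  additive, whereas the supports of the factors may differ.\<close>

lemma sum_lookup_superset:
  fixes t :: "nat \<Rightarrow>\<^sub>0 nat"
  assumes "Poly_Mapping.keys t \<subseteq> {..m}"
  shows "(\<Sum>i\<in>Poly_Mapping.keys t. Poly_Mapping.lookup t i) = (\<Sum>i\<le>m. Poly_Mapping.lookup t i)"
  by (rule sum.mono_neutral_left) (use assms in \<open>auto simp: in_keys_iff\<close>)

lemma hom_polys_mult:
  assumes f: "f \<in> hom_polys m v" and g: "g \<in> hom_polys m w"
  shows "f * g \<in> hom_polys m (v + w)"
proof -
  have "Poly_Mapping.keys u \<subseteq> {..m} \<and>
      (\<Sum>i\<in>Poly_Mapping.keys u. Poly_Mapping.lookup u i) = v + w"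
    if "u \<in> Poly_Mapping.keys (f * g)" for u
  proof -
    from that keys_mult[of f g] obtain s t
      where st: "u = s + t" "s \<in> Poly_Mapping.keys f" "t \<in> Poly_Mapping.keys g" by blast
    have s: "Poly_Mapping.keys s \<subseteq> {..m}"
        "(\<Sum>i\<in>Poly_Mapping.keys s. Poly_Mapping.lookup s i) = v"
      using f st by (auto simp: hom_polys_def)
    have t: "Poly_Mapping.keys t \<subseteq> {..m}"
        "(\<Sum>i\<in>Poly_Mapping.keys t. Poly_Mapping.lookup t i) = w"
      using g st by (auto simp: hom_polys_def)
    have u: "Poly_Mapping.keys u \<subseteq> {..m}"
      using s(1) t(1) keys_add[of s t] st by blast
    show ?thesis
      using u s t unfolding sum_lookup_superset[OF u] sum_lookup_superset[OF s(1)]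
        sum_lookup_superset[OF t(1)] by (simp add: st(1) lookup_add sum.distrib)
  qed
  then show ?thesis by (simp add: hom_polys_def)
qed

lemma hom_polys_const: "mp_const c \<in> hom_polys m 0"
  by (simp add: hom_polys_def mp_const_def)

lemma hom_polys_var: "i \<le> m \<Longrightarrow> mp_var i \<in> hom_polys m 1"
  by (simp add: hom_polys_def mp_var_def)

lemma hom_polys_one: "1 \<in> hom_polys m 0"
  using hom_polys_const[of 1 m] by (simp add: mp_const_def)

lemma hom_polys_power:
  assumes "f \<in> hom_polys m v"
  shows "f ^ n \<in> hom_polys m (n * v)"
  by (induction n) (simp_all add: hom_polys_one hom_polys_mult assms)

lemma hom_polys_prod:
  assumes "\<And>i. i \<in> A \<Longrightarrow> F i \<in> hom_polys m (e i)"
  shows "(\<Prod>i\<in>A. F i) \<in> hom_polys m (\<Sum>i\<in>A. e i)"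
  using assms
  by (induction A rule: infinite_finite_induct) (simp_all add: hom_polys_one hom_polys_mult)

text \<open>Each monomial of degree \<open>v\<close> turns into a product of \<open>v\<close> linear
  forms, counted with multiplicity.\<close>

lemma hom_polys_subst:
  assumes f: "f \<in> hom_polys m v" and y: "\<And>i. y i \<in> hom_polys r 1"
  shows "mp_subst mp_const y f \<in> hom_polys r v"
  unfolding mp_subst_def
proof (rule hom_polys_sum)
  fix t assume "t \<in> Poly_Mapping.keys f"
  then have "(\<Sum>i\<in>Poly_Mapping.keys t. Poly_Mapping.lookup t i) = v"
    using f by (simp add: hom_polys_def)
  moreover have "(\<Prod>i\<in>Poly_Mapping.keys t. y i ^ Poly_Mapping.lookup t i)
      \<in> hom_polys r (\<Sum>i\<in>Poly_Mapping.keys t. Poly_Mapping.lookup t i)"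
    by (rule hom_polys_prod) (use hom_polys_power[OF y] in simp)
  ultimately show "mp_const (Poly_Mapping.lookup f t) *
      (\<Prod>i\<in>Poly_Mapping.keys t. y i ^ Poly_Mapping.lookup t i) \<in> hom_polys r v"
    using hom_polys_mult[OF hom_polys_const] by fastforce
qed

text \<open>Only the variables with index at most \<open>m\<close> occur. This matters because
  entries of a vector beyond its dimension are unspecified.\<close>

lemma mp_subst_cong_hom:
  assumes "f \<in> hom_polys m v" "\<And>i. i \<le> m \<Longrightarrow> x i = y i"
  shows "mp_subst h x f = mp_subst h y f"
  unfolding mp_subst_def
  by (intro sum.cong prod.cong refl arg_cong2[where f = "(*)"])
    (use assms in \<open>fastforce simp: hom_polys_def\<close>)

lemma mp_eval_smult:
  assumes f: "f \<in> hom_polys m v" and x: "x \<in> carrier_vec (m + 1)"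
  shows "mp_eval f (c \<cdot>\<^sub>v x) = c ^ v * mp_eval f x"
proof -
  have "mp_eval f (c \<cdot>\<^sub>v x) = mp_subst id (\<lambda>i. c * x $ i) f"
    unfolding mp_eval_def by (rule mp_subst_cong_hom[OF f]) (use x in auto)
  also have "\<dots> = c ^ v * mp_eval f x"
    unfolding mp_eval_def mp_subst_def sum_distrib_left
  proof (rule sum.cong[OF refl])
    fix t assume "t \<in> Poly_Mapping.keys f"
    then have "(\<Sum>i\<in>Poly_Mapping.keys t. Poly_Mapping.lookup t i) = v"
      using f by (simp add: hom_polys_def)
    then show "id (Poly_Mapping.lookup f t) *
        (\<Prod>i\<in>Poly_Mapping.keys t. (c * x $ i) ^ Poly_Mapping.lookup t i) =
      c ^ v * (id (Poly_Mapping.lookup f t) *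
        (\<Prod>i\<in>Poly_Mapping.keys t. x $ i ^ Poly_Mapping.lookup t i))"
      by (simp add: power_mult_distrib prod.distrib power_sum[symmetric] mult_ac)
  qed
  finally show ?thesis .
qed

section \<open>Linear substitutions\<close>

text \<open>The matrix form of a linear map: column \<open>j\<close> is the image of the
  \<open>j\<close>-th unit vector.\<close>

lemma linear_vec_map_expand:
  assumes L: "linear_vec_map a b L" and y: "y \<in> carrier_vec a" and i: "i < b"
  shows "L y $ i = (\<Sum>j<a. L (unit_vec a j) $ i * y $ j)"
proof -
  have add: "L (x + y) = L x + L y" if "x \<in> carrier_vec a" "y \<in> carrier_vec a" for x y
    using L that by (auto simp: linear_vec_map_def)
  have sm: "L (c \<cdot>\<^sub>v x) = c \<cdot>\<^sub>v L x" if "x \<in> carrier_vec a" for c x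
    using L that by (auto simp: linear_vec_map_def)
  have cl: "L x \<in> carrier_vec b" if "x \<in> carrier_vec a" for x
    using L that by (auto simp: linear_vec_map_def)
  \<comment> \<open>Induction on the length \<open>k\<close> of an initial segment outside which
    \<open>y\<close> vanishes; \<open>k = a\<close> is the claim.\<close>
  have "L y $ i = (\<Sum>j<k. L (unit_vec a j) $ i * y $ j)"
    if "k \<le> a" "y \<in> carrier_vec a" "\<forall>j. k \<le> j \<longrightarrow> j < a \<longrightarrow> y $ j = 0" for k y
    using that
  proof (induction k arbitrary: y)
    case 0
    then have "y = 0 \<cdot>\<^sub>v y" by (intro eq_vecI) auto
    then have "L y = 0 \<cdot>\<^sub>v L y" using sm[of y 0] 0 by simp
    then have "L y $ i = (0 \<cdot>\<^sub>v L y) $ i" by simp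
    also have "\<dots> = 0" using cl[OF 0(2)] i by auto
    finally show ?case by simp
  next
    case (Suc k)
    \<comment> \<open>The truncation of \<open>y\<close> before coordinate \<open>k\<close>: it
      differs from \<open>y\<close> by a multiple of one unit vector.\<close>
    define z where "z = vec a (\<lambda>j. if j < k then y $ j else 0)"
    have z: "z \<in> carrier_vec a" by (simp add: z_def)
    have k: "k < a" using Suc.prems by simp
    have yz: "y = z + y $ k \<cdot>\<^sub>v unit_vec a k"
    proof (rule eq_vecI)
      fix j assume "j < dim_vec (z + y $ k \<cdot>\<^sub>v unit_vec a k)"
      then have "j < a" by simp
      then show "y $ j = (z + y $ k \<cdot>\<^sub>v unit_vec a k) $ j"
        using Suc.prems(3) k by (cases "j < k"; cases "j = k") (auto simp: z_def)
    qed (use Suc.prems in auto)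
    have "L y = L z + y $ k \<cdot>\<^sub>v L (unit_vec a k)"
      using add[OF z, of "y $ k \<cdot>\<^sub>v unit_vec a k"] sm[of "unit_vec a k" "y $ k"] yz by simp
    then have "L y $ i = L z $ i + y $ k * L (unit_vec a k) $ i"
      using cl[OF z] cl[of "unit_vec a k"] i by auto
    moreover have "L z $ i = (\<Sum>j<k. L (unit_vec a j) $ i * z $ j)"
      by (rule Suc.IH) (use k z in \<open>auto simp: z_def\<close>)
    moreover have "(\<Sum>j<k. L (unit_vec a j) $ i * z $ j) = (\<Sum>j<k. L (unit_vec a j) $ i * y $ j)"
      using k by (intro sum.cong) (auto simp: z_def)
    ultimately show ?case by (simp add: mult.commute)
  qed
  then show ?thesis using y by auto
qed

text \<open>The polynomial \<open>f \<circ> A\<close> in \<open>r + 1\<close> variables. It covers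
  both restriction to a line (\<open>r = 1\<close>) and a linear change of coordinates
  (\<open>r = m\<close>).\<close>

definition mp_lin :: "nat \<Rightarrow> ('a::field vec \<Rightarrow> 'a vec) \<Rightarrow> 'a mpol \<Rightarrow> 'a mpol" where
  "mp_lin r A = mp_subst mp_const
     (\<lambda>i. \<Sum>j<r + 1. mp_const (A (unit_vec (r + 1) j) $ i) * mp_var j)"

lemma mp_comp_eq_mp_lin: "mp_comp f L = mp_lin 1 L f"
  by (simp add: mp_comp_def mp_lin_def numeral_2_eq_2)

lemma hom_polys_mp_lin:
  assumes "f \<in> hom_polys m v"
  shows "mp_lin r A f \<in> hom_polys r v"
  unfolding mp_lin_def
proof (rule hom_polys_subst[OF assms], rule hom_polys_sum)
  fix i j assume "j \<in> {..<r + 1}"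
  then show "mp_const (A (unit_vec (r + 1) j) $ i) * mp_var j \<in> hom_polys r 1"
    using hom_polys_mult[OF hom_polys_const hom_polys_var, of j r] by simp
qed

lemma mp_eval_mp_lin:
  assumes f: "f \<in> hom_polys m v" and A: "linear_vec_map (r + 1) (m + 1) A"
    and x: "x \<in> carrier_vec (r + 1)"
  shows "mp_eval (mp_lin r A f) x = mp_eval f (A x)"
  unfolding mp_lin_def mp_eval_subst
  unfolding mp_eval_def[of f]
  by (rule mp_subst_cong_hom[OF f])
    (simp add: mp_eval_add mp_eval_sum mp_eval_mult linear_vec_map_expand[OF A x])

section \<open>Standard representatives and lifted codes\<close>

text \<open>Dividing \<open>u\<close> by its leftmost nonzero coordinate gives a standard vector.
  Nonzero scaling keeps the position of that coordinate, so the condition that it be 1 determines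
  the scalar.\<close>

lemma ex1_standard_rep:
  fixes u :: "'a::field vec"
  assumes u: "u \<in> carrier_vec (m + 1) - {0\<^sub>v (m + 1)}"
  shows "\<exists>!x. x \<in> proj_point m u \<and> standard_vec x"
proof -
  have dim: "dim_vec u = m + 1" using u by auto
  have "\<exists>i. i < m + 1 \<and> u $ i \<noteq> 0"
    using u dim by (metis Diff_iff eq_vecI index_zero_vec singletonI)
  then obtain i where i: "i < m + 1" "u $ i \<noteq> 0" and min: "\<And>j. j < i \<Longrightarrow> u $ j = 0"
    using exists_least_iff[of "\<lambda>i. i < m + 1 \<and> u $ i \<noteq> 0"] by (metis less_trans)
  define x where "x = inverse (u $ i) \<cdot>\<^sub>v u"
  have xi: "x $ i = 1" "\<And>j. j < i \<Longrightarrow> x $ j = 0"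
    using i min dim by (simp_all add: x_def)
  have x: "x \<in> proj_point m u"
  proof -
    have "x \<noteq> 0\<^sub>v (m + 1)" using xi(1) i by auto
    moreover have "x \<in> carrier_vec (m + 1)" using u by (simp add: x_def)
    ultimately show ?thesis
      using u i unfolding proj_point_def proj_rel_def
      by (auto simp: x_def intro!: exI[of _ "inverse (u $ i)"])
  qed
  have std: "standard_vec x"
    unfolding standard_vec_def using xi i dim by (auto simp: x_def)
  have "y = x" if y: "y \<in> proj_point m u" "standard_vec y" for y
  proof -
    from y(1) obtain a where a: "a \<noteq> 0" "y = a \<cdot>\<^sub>v u"
      by (auto simp: proj_point_def proj_rel_def)
    from y(2) obtain l where l: "l < m + 1" "y $ l = 1" "\<forall>j<l. y $ j = 0"
      using a dim by (auto simp: standard_vec_def)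
    have "\<not> l < i" using min[of l] l a dim by auto
    moreover have "\<not> i < l" using l i a dim by auto
    ultimately have "l = i" by simp
    then have "a * u $ i = 1" using l a dim by simp
    then have "a = inverse (u $ i)" by (metis inverse_unique mult.commute)
    then show ?thesis using a by (simp add: x_def)
  qed
  with x std show ?thesis by blast
qed

lemma std_rep_in_carrier:
  assumes "P \<in> proj_space m"
  shows "std_rep P \<in> carrier_vec (m + 1)"
proof -
  from assms obtain u where u: "u \<in> carrier_vec (m + 1) - {0\<^sub>v (m + 1)}" "P = proj_point m u"
    by (auto simp: proj_space_def proj_point_def elim!: quotientE)
  have "std_rep P \<in> P"
    using theI'[OF ex1_standard_rep[OF u(1)]] unfolding std_rep_def u(2) by blast
  then show ?thesis using u by (auto simp: proj_point_def proj_rel_def)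
qed

text \<open>The scalar exists because \<open>u\<close> and its standard representative span the same
  line. It is unique because it can be read off at a coordinate where the representative is
  1.\<close>

lemma proj_weight_smult_std_rep:
  fixes u :: "'a::field vec"
  assumes u: "u \<in> carrier_vec (m + 1) - {0\<^sub>v (m + 1)}"
  shows "u = proj_weight m u \<cdot>\<^sub>v std_rep (proj_point m u)"
proof -
  let ?s = "std_rep (proj_point m u)"
  have s: "?s \<in> proj_point m u" "standard_vec ?s"
    using theI'[OF ex1_standard_rep[OF u]] unfolding std_rep_def by blast+
  then obtain a where a: "a \<noteq> 0" "?s = a \<cdot>\<^sub>v u"
    by (auto simp: proj_point_def proj_rel_def)
  from s(2) obtain i where i: "i < dim_vec ?s" "?s $ i = 1"
    by (auto simp: standard_vec_def)
  have "inverse a \<noteq> 0 \<and> u = inverse a \<cdot>\<^sub>v ?s"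
    using a by (simp add: smult_smult_assoc)
  moreover have "w = w'" if "u = w \<cdot>\<^sub>v ?s" "u = w' \<cdot>\<^sub>v ?s" for w w'
  proof -
    have "(w \<cdot>\<^sub>v ?s) $ i = (w' \<cdot>\<^sub>v ?s) $ i" using that by metis
    then show ?thesis using i by simp
  qed
  ultimately have "\<exists>!w. w \<noteq> 0 \<and> u = w \<cdot>\<^sub>v ?s" by blast
  from theI'[OF this] show ?thesis unfolding proj_weight_def by blast
qed

lemma weighted_proj_ev:
  assumes f: "f \<in> hom_polys m v" and u: "u \<in> carrier_vec (m + 1) - {0\<^sub>v (m + 1)}"
  shows "proj_weight m u ^ v * proj_ev m f (proj_point m u) = mp_eval f u"
proof -
  have P: "proj_point m u \<in> proj_space m"
    using u by (auto simp: proj_space_def proj_point_def intro: quotientI)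
  have "mp_eval f u = mp_eval f (proj_weight m u \<cdot>\<^sub>v std_rep (proj_point m u))"
    using proj_weight_smult_std_rep[OF u] by simp
  also have "\<dots> = proj_weight m u ^ v * mp_eval f (std_rep (proj_point m u))"
    by (rule mp_eval_smult[OF f std_rep_in_carrier[OF P]])
  finally show ?thesis using P by (simp add: proj_ev_def)
qed

section \<open>Invariance of lifted codes under linear automorphisms\<close>

definition lift_polys :: "nat \<Rightarrow> nat \<Rightarrow> 'a::{field,finite} mpol set" where
  "lift_polys m k = {f \<in> hom_polys m (k + (m - 1) * (CARD('a) - 1)).
     \<forall>L\<in>Emb_proj m. proj_ev 1 (mp_comp f L) \<in> PRS k}"

text \<open>The map \<open>A \<circ> L\<close> is again an embedding of the line, and restricting
  \<open>f \<circ> A\<close> along \<open>L\<close> gives the same values as restricting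
  \<open>f\<close> along \<open>A \<circ> L\<close>.\<close>

lemma lift_polys_mp_lin:
  fixes f :: "'a::{field,finite} mpol"
  assumes f: "f \<in> lift_polys m k" and A: "linear_vec_map (m + 1) (m + 1) A"
    and inj: "inj_on A (carrier_vec (m + 1))"
  shows "mp_lin m A f \<in> lift_polys m k"
proof -
  define v where "v = k + (m - 1) * (CARD('a) - 1)"
  have fv: "f \<in> hom_polys m v" using f by (simp add: lift_polys_def v_def)
  have "proj_ev 1 (mp_comp (mp_lin m A f) L) \<in> PRS k" if L: "L \<in> Emb_proj m" for L
  proof -
    have lin: "linear_vec_map 2 (m + 1) L" and injL: "inj_on L (carrier_vec 2)"
      using L by (auto simp: Emb_proj_def)
    have LC: "L \<in> carrier_vec 2 \<rightarrow> carrier_vec (m + 1)"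
      using lin by (simp add: linear_vec_map_def)
    have AL: "linear_vec_map 2 (m + 1) (A \<circ> L)"
      using lin A by (auto simp: linear_vec_map_def Pi_iff)
    have "inj_on (A \<circ> L) (carrier_vec 2)"
      by (rule comp_inj_on[OF injL]) (rule inj_on_subset[OF inj], use LC in auto)
    with AL have "A \<circ> L \<in> Emb_proj m" by (simp add: Emb_proj_def)
    then have "proj_ev 1 (mp_comp f (A \<circ> L)) \<in> PRS k"
      using f by (simp add: lift_polys_def)
    \<comment> \<open>Membership in \<open>PRS k\<close> concerns evaluations only, so equality of
      values on the line suffices and no identity of polynomials has to be shown.\<close>
    moreover have "proj_ev 1 (mp_comp f (A \<circ> L)) = proj_ev 1 (mp_comp (mp_lin m A f) L)"
      unfolding proj_ev_def
    proof (rule restrict_ext)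
      fix P :: "'a vec set" assume "P \<in> proj_space 1"
      then have x: "std_rep P \<in> carrier_vec (1 + 1)" by (rule std_rep_in_carrier)
      have "mp_eval (mp_comp f (A \<circ> L)) (std_rep P) = mp_eval f (A (L (std_rep P)))"
        unfolding mp_comp_eq_mp_lin
        by (subst mp_eval_mp_lin[OF fv _ x]) (use AL in \<open>simp_all add: numeral_2_eq_2\<close>)
      also have "\<dots> = mp_eval (mp_lin m A f) (L (std_rep P))"
        by (rule mp_eval_mp_lin[OF fv A, symmetric]) (use LC x in \<open>auto simp: numeral_2_eq_2\<close>)
      also have "\<dots> = mp_eval (mp_comp (mp_lin m A f) L) (std_rep P)"
        unfolding mp_comp_eq_mp_lin
        by (subst mp_eval_mp_lin[OF hom_polys_mp_lin[OF fv] _ x])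
          (use lin in \<open>simp_all add: numeral_2_eq_2\<close>)
      finally show "mp_eval (mp_comp f (A \<circ> L)) (std_rep P) =
          mp_eval (mp_comp (mp_lin m A f) L) (std_rep P)" .
    qed
    ultimately show ?thesis by simp
  qed
  then show ?thesis
    using hom_polys_mp_lin[OF fv] by (simp add: lift_polys_def v_def)
qed

lemma weighted_code_PLift:
  fixes X :: "'a::{field,finite} vec set"
  assumes "v = k + (m - 1) * (CARD('a) - 1)" and X: "X \<subseteq> carrier_vec (m + 1) - {0\<^sub>v (m + 1)}"
  shows "weighted_code m v X (PLift m k) = (\<lambda>f. \<lambda>u\<in>X. mp_eval f u) ` lift_polys m k"
proof -
  have "PLift m k = proj_ev m ` (lift_polys m k :: 'a mpol set)"
    by (simp add: PLift_def lift_polys_def)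
  then have "weighted_code m v X (PLift m k) =
      (\<lambda>f. \<lambda>u\<in>X. proj_weight m u ^ v * proj_ev m f (proj_point m u)) ` lift_polys m k"
    by (simp add: weighted_code_def image_image)
  also have "\<dots> = (\<lambda>f. \<lambda>u\<in>X. mp_eval f u) ` lift_polys m k"
    using X assms(1)
    by (intro image_cong refl restrict_ext weighted_proj_ev) (auto simp: lift_polys_def)
  finally show ?thesis .
qed

text \<open>The action on codewords uses the inverse of \<open>\<sigma>\<close>, so the codeword of
  \<open>f\<close> goes to that of \<open>f \<circ> B\<close>, with \<open>B\<close> inverse to
  \<open>A\<close>. This gives one inclusion; the other holds because the codeword of
  \<open>f\<close> is the image of that of \<open>f \<circ> A\<close>.\<close>

lemma perm_act_weighted_PLift:
  fixes X :: "'a::{field,finite} vec set"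
  assumes v: "v = k + (m - 1) * (CARD('a) - 1)"
    and X: "X \<subseteq> carrier_vec (m + 1) - {0\<^sub>v (m + 1)}"
    and A: "linear_vec_map (m + 1) (m + 1) A" "inj_on A (carrier_vec (m + 1))"
    and B: "linear_vec_map (m + 1) (m + 1) B" "inj_on B (carrier_vec (m + 1))"
    and AB: "\<And>x. x \<in> carrier_vec (m + 1) \<Longrightarrow> A (B x) = x"
    and \<sigma>: "\<sigma> permutes X" "\<And>x. x \<in> X \<Longrightarrow> \<sigma> x = A x"
  shows "perm_act X \<sigma> ` weighted_code m v X (PLift m k) = weighted_code m v X (PLift m k)"
proof -
  have lp: "f \<in> hom_polys m v" if "f \<in> lift_polys m k" for f :: "'a mpol"
    using that v by (simp add: lift_polys_def)
  have BC: "B x \<in> carrier_vec (m + 1)" if "x \<in> carrier_vec (m + 1)" for x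
    using B(1) that by (auto simp: linear_vec_map_def)
  \<comment> \<open>A right inverse of an injective map is also a left inverse: cancel
    \<open>A\<close> in \<open>A (B (A x)) = A x\<close>.\<close>
  have BA: "B (A x) = x" if "x \<in> carrier_vec (m + 1)" for x
  proof -
    have "A x \<in> carrier_vec (m + 1)" using A(1) that by (auto simp: linear_vec_map_def)
    then show ?thesis using A(2) AB that BC by (meson inj_onD)
  qed
  have inv_X: "inv_into UNIV \<sigma> u \<in> X" if "u \<in> X" for u
    using permutes_in_image[OF permutes_inv[OF \<sigma>(1)]] that by blast
  have inv_eq: "inv_into UNIV \<sigma> u = B u" if u: "u \<in> X" for u
  proof -
    have "A (inv_into UNIV \<sigma> u) = u"
      using \<sigma>(2)[OF inv_X[OF u]] permutes_inverses(1)[OF \<sigma>(1)] by simp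
    then show ?thesis using BA[of "inv_into UNIV \<sigma> u"] inv_X[OF u] X by auto
  qed
  have act: "perm_act X \<sigma> (\<lambda>u\<in>X. mp_eval f u) = (\<lambda>u\<in>X. mp_eval (mp_lin m B f) u)"
    if "f \<in> lift_polys m k" for f
    unfolding perm_act_def
  proof (rule restrict_ext)
    fix u assume u: "u \<in> X"
    then have "mp_eval (mp_lin m B f) u = mp_eval f (B u)"
      using X by (intro mp_eval_mp_lin[OF lp[OF that] B(1)]) auto
    then show "(\<lambda>u\<in>X. mp_eval f u) (inv_into UNIV \<sigma> u) = mp_eval (mp_lin m B f) u"
      using inv_X[OF u] inv_eq[OF u] by simp
  qed
  have "(\<lambda>u\<in>X. mp_eval f u) \<in> perm_act X \<sigma> ` (\<lambda>f. \<lambda>u\<in>X. mp_eval f u) ` lift_polys m k"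
    if f: "f \<in> lift_polys m k" for f
  proof -
    have g: "mp_lin m A f \<in> lift_polys m k" by (rule lift_polys_mp_lin[OF f A])
    have "mp_eval (mp_lin m B (mp_lin m A f)) u = mp_eval f u" if "u \<in> X" for u
    proof -
      have u: "u \<in> carrier_vec (m + 1)" using that X by auto
      show ?thesis
        using mp_eval_mp_lin[OF lp[OF g] B(1) u] mp_eval_mp_lin[OF lp[OF f] A(1) BC[OF u]]
          AB[OF u] by simp
    qed
    then have "(\<lambda>u\<in>X. mp_eval f u) = perm_act X \<sigma> (\<lambda>u\<in>X. mp_eval (mp_lin m A f) u)"
      unfolding act[OF g] by (intro restrict_ext) simp
    then show ?thesis using g by blast
  qed
  moreover have "perm_act X \<sigma> (\<lambda>u\<in>X. mp_eval f u) \<in> (\<lambda>f. \<lambda>u\<in>X. mp_eval f u) ` lift_polys m k"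
    if f: "f \<in> lift_polys m k" for f
    unfolding act[OF f] using lift_polys_mp_lin[OF f B] by blast
  ultimately show ?thesis
    unfolding weighted_code_PLift[OF v X] by blast
qed

section \<open>Products of disjoint cycles\<close>

text \<open>Applying the cycle to every entry of its list rotates the list by one place.\<close>

lemma cycle_of_list_nth:
  assumes "distinct cs" "j < length cs"
  shows "cycle_of_list cs (cs ! j) = cs ! (Suc j mod length cs)"
proof -
  have "map (cycle_of_list cs) cs = rotate1 cs"
    using cyclic_rotation[OF assms(1), of 1] by simp
  then have "map (cycle_of_list cs) cs ! j = rotate1 cs ! j" by simp
  then show ?thesis using assms by (simp add: nth_rotate1)
qed

lemma foldr_cycles_outside:
  assumes "\<And>cs. cs \<in> set css \<Longrightarrow> x \<notin> set cs"
  shows "foldr (\<circ>) (map cycle_of_list css) id x = x"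
  using assms by (induction css) (auto simp: id_outside_supp)

text \<open>The cycles applied before that of \<open>x\<close> fix \<open>x\<close>; those applied
  after it fix its image, which stays in the same support.\<close>

lemma foldr_cycles_inside:
  assumes "i < length css" "x \<in> set (css ! i)"
    and "\<And>i j. i < length css \<Longrightarrow> j < length css \<Longrightarrow> i \<noteq> j \<Longrightarrow> set (css ! i) \<inter> set (css ! j) = {}"
  shows "foldr (\<circ>) (map cycle_of_list css) id x = cycle_of_list (css ! i) x"
  using assms
proof (induction css arbitrary: i)
  case (Cons c css)
  have disj: "set c \<inter> set (css ! l) = {}" if "l < length css" for l
    using Cons.prems(3)[of 0 "Suc l"] that by simp
  have head: "foldr (\<circ>) (map cycle_of_list (c # css)) id x =
      cycle_of_list c (foldr (\<circ>) (map cycle_of_list css) id x)"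
    by simp
  show ?case
  proof (cases i)
    case 0
    then have "x \<in> set c" using Cons.prems by simp
    then have "foldr (\<circ>) (map cycle_of_list css) id x = x"
      using disj by (intro foldr_cycles_outside) (metis disjoint_iff in_set_conv_nth)
    with head 0 show ?thesis by (metis nth_Cons_0)
  next
    case (Suc l)
    then have l: "l < length css" "x \<in> set (css ! l)" using Cons.prems by auto
    have "foldr (\<circ>) (map cycle_of_list css) id x = cycle_of_list (css ! l) x"
      using l
    proof (rule Cons.IH)
      fix i j assume "i < length css" "j < length css" "i \<noteq> j"
      then show "set (css ! i) \<inter> set (css ! j) = {}"
        using Cons.prems(3)[of "Suc i" "Suc j"] by simp
    qed
    moreover have "cycle_of_list (css ! l) x \<in> set (css ! l)"
      using permutes_in_image[OF cycle_permutes] l by metis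
    then have "cycle_of_list c (cycle_of_list (css ! l) x) = cycle_of_list (css ! l) x"
      using disj[OF l(1)] by (intro id_outside_supp) auto
    ultimately show ?thesis using Suc head by (metis nth_Cons_Suc)
  qed
qed simp

lemma foldr_cycles_permutes:
  assumes "\<And>cs. cs \<in> set css \<Longrightarrow> set cs \<subseteq> X"
  shows "foldr (\<circ>) (map cycle_of_list css) id permutes X"
  using assms
  by (induction css)
    (auto intro!: permutes_compose permutes_subset[OF cycle_permutes] simp: permutes_id)

lemma orbit_of_cyclic_shift:
  assumes shift: "\<And>j. j < length cs \<Longrightarrow> \<sigma> (cs ! j) = cs ! (Suc j mod length cs)"
    and x: "x \<in> set cs"
  shows "orbit \<sigma> x = set cs"
proof -
  obtain j where j: "j < length cs" "x = cs ! j" using x by (auto simp: in_set_conv_nth)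
  have pow: "(\<sigma> ^^ k) x = cs ! ((j + k) mod length cs)" for k
  proof (induction k)
    case (Suc k)
    have "\<sigma> (cs ! ((j + k) mod length cs)) = cs ! (Suc ((j + k) mod length cs) mod length cs)"
      by (rule shift) (use j in \<open>auto intro!: mod_less_divisor\<close>)
    with Suc show ?case by (simp add: mod_Suc_eq)
  qed (use j in simp)
  show ?thesis
  proof (intro equalityI subsetI)
    fix y assume "y \<in> orbit \<sigma> x"
    then obtain k where "y = (\<sigma> ^^ k) x" by (auto simp: orbit_altdef)
    moreover have "(j + k) mod length cs < length cs"
      using j by (intro mod_less_divisor) auto
    ultimately show "y \<in> set cs" by (simp add: pow)
  next
    fix y assume "y \<in> set cs"
    then obtain l where l: "l < length cs" "y = cs ! l" by (auto simp: in_set_conv_nth)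
    \<comment> \<open>Adding \<open>length cs\<close> keeps the exponent positive even for
      \<open>l \<le> j\<close>; \<open>orbit\<close> contains positive iterates only.\<close>
    have "(\<sigma> ^^ (l + length cs - j)) x = y"
      using j(1) l unfolding pow by simp
    moreover have "0 < l + length cs - j" using j by simp
    ultimately show "y \<in> orbit \<sigma> x" unfolding orbit_altdef by blast
  qed
qed

lemma eq_foldr_cycles:
  assumes dist: "\<And>cs. cs \<in> set css \<Longrightarrow> distinct cs"
    and disj: "\<And>i j. i < length css \<Longrightarrow> j < length css \<Longrightarrow> i \<noteq> j \<Longrightarrow>
      set (css ! i) \<inter> set (css ! j) = {}"
    and shift: "\<And>cs j. cs \<in> set css \<Longrightarrow> j < length cs \<Longrightarrow> \<sigma> (cs ! j) = cs ! (Suc j mod length cs)"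
    and outside: "\<And>x. (\<And>cs. cs \<in> set css \<Longrightarrow> x \<notin> set cs) \<Longrightarrow> \<sigma> x = x"
  shows "\<sigma> = foldr (\<circ>) (map cycle_of_list css) id"
proof
  fix x
  show "\<sigma> x = foldr (\<circ>) (map cycle_of_list css) id x"
  proof (cases "\<exists>cs\<in>set css. x \<in> set cs")
    case True
    then obtain i where i: "i < length css" "x \<in> set (css ! i)"
      by (auto simp: in_set_conv_nth[of _ css])
    then obtain j where j: "j < length (css ! i)" "x = css ! i ! j"
      by (auto simp: in_set_conv_nth)
    have "css ! i \<in> set css" using i by simp
    then have "\<sigma> x = cycle_of_list (css ! i) x"
      using shift dist j by (simp add: cycle_of_list_nth)
    also have "\<dots> = foldr (\<circ>) (map cycle_of_list css) id x"
      by (rule foldr_cycles_inside[OF i disj, symmetric])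
    finally show ?thesis .
  next
    case False
    then have "\<sigma> x = x" by (intro outside) blast
    then show ?thesis using False foldr_cycles_outside[of css x] by auto
  qed
qed

section \<open>Powers of a primitive element\<close>

text \<open>The definition of a primitive element only says that its powers exhaust the nonzero
  elements; its exact order \<open>CARD('b) - 1\<close> is derived here by counting.\<close>

lemma primitive_element_powers:
  fixes \<omega> :: "'b::{field,finite}"
  assumes "primitive_element \<omega>"
  shows "inj_on ((^) \<omega>) {..<CARD('b) - 1}" and "\<omega> ^ (CARD('b) - 1) = 1"
proof -
  let ?N = "CARD('b) - 1"
  have nz: "\<omega> \<noteq> 0" and gen: "\<And>x. x \<noteq> 0 \<Longrightarrow> \<exists>i. x = \<omega> ^ i"
    using assms by (auto simp: primitive_element_def)
  have cardU: "card (UNIV - {0 :: 'b}) = ?N" by (simp add: card_Diff_singleton)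
  \<comment> \<open>If \<open>\<omega> ^ k = 1\<close>, the first \<open>k\<close> powers already
    exhaust the nonzero elements.\<close>
  have order_ge: "?N \<le> k" if k: "0 < k" "\<omega> ^ k = 1" for k
  proof -
    have "UNIV - {0} \<subseteq> (^) \<omega> ` {..<k}"
    proof
      fix x :: 'b assume "x \<in> UNIV - {0}"
      then obtain i where "x = \<omega> ^ i" using gen by blast
      also have "\<dots> = \<omega> ^ (k * (i div k) + i mod k)" by simp
      also have "\<dots> = \<omega> ^ (i mod k)"
        unfolding power_add power_mult k(2) by simp
      finally show "x \<in> (^) \<omega> ` {..<k}" using k by auto
    qed
    then have "?N \<le> card ((^) \<omega> ` {..<k})"
      unfolding cardU[symmetric] by (intro card_mono) auto
    also have "\<dots> \<le> k" using card_image_le[of "{..<k}" "(^) \<omega>"] by simp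
    finally show ?thesis .
  qed
  have period: "\<omega> ^ (b - a) = 1" if "a \<le> b" "\<omega> ^ a = \<omega> ^ b" for a b
    using power_diff[OF nz that(1)] that(2) nz by simp
  show inj: "inj_on ((^) \<omega>) {..<?N}"
  proof (rule linorder_inj_onI)
    fix a b assume "a < b" "a \<in> {..<?N}" "b \<in> {..<?N}"
    then show "\<omega> ^ a \<noteq> \<omega> ^ b" using order_ge[of "b - a"] period[of a b] by auto
  qed (rule linear)
  have "card ((^) \<omega> ` {..<?N}) = card (UNIV - {0 :: 'b})"
    using card_image[OF inj] cardU by simp
  moreover have "(^) \<omega> ` {..<?N} \<subseteq> UNIV - {0}" using nz by auto
  ultimately have "(^) \<omega> ` {..<?N} = UNIV - {0}"
    by (intro card_subset_eq) auto
  moreover have "\<omega> ^ ?N \<in> UNIV - {0}" using nz by simp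
  \<comment> \<open>The first \<open>?N\<close> powers are all nonzero elements, so the next power
    repeats one of them; the lower bound on the order leaves only the repetition of
    \<open>\<omega> ^ 0\<close>.\<close>
  ultimately obtain i where i: "i < ?N" "\<omega> ^ ?N = \<omega> ^ i" by (metis imageE lessThan_iff)
  then have "?N \<le> ?N - i" using order_ge[of "?N - i"] period[of i ?N] by simp
  then have "i = 0" using i by simp
  then show "\<omega> ^ ?N = 1" using i by simp
qed

section \<open>Multiplication maps\<close>

lemma inv_vs_iso: "vs_iso \<iota> r \<phi> \<Longrightarrow> inv_into UNIV \<phi> (\<phi> x) = x"
  by (simp add: vs_iso_def bij_betw_def)

lemma vs_iso_inv: "vs_iso \<iota> r \<phi> \<Longrightarrow> x \<in> carrier_vec r \<Longrightarrow> \<phi> (inv_into UNIV \<phi> x) = x"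
  by (metis bij_betw_imp_surj_on f_inv_into_f vs_iso_def)

lemma vs_iso_carrier: "vs_iso \<iota> r \<phi> \<Longrightarrow> \<phi> x \<in> carrier_vec r"
  by (auto simp: vs_iso_def bij_betw_def)

text \<open>If \<open>\<phi> x\<close> were zero, additivity and injectivity would give
  \<open>x + x = x\<close>.\<close>

lemma vs_iso_nonzero:
  assumes \<phi>: "vs_iso \<iota> r \<phi>" and x: "x \<noteq> 0"
  shows "\<phi> x \<noteq> 0\<^sub>v r"
proof
  assume "\<phi> x = 0\<^sub>v r"
  moreover have "\<phi> (x + x) = \<phi> x + \<phi> x" using \<phi> unfolding vs_iso_def by blast
  ultimately have "\<phi> (x + x) = \<phi> x" by (metis left_zero_vec zero_carrier_vec)
  then have "x + x = x" using \<phi> by (metis inv_vs_iso)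
  then show False using x add_cancel_right_right[of x x] by simp
qed

lemma mult_map_apply: "vs_iso \<iota> r \<phi> \<Longrightarrow> mult_map \<phi> b (\<phi> x) = \<phi> (b * x)"
  by (simp add: mult_map_def inv_vs_iso)

lemma mult_map_mult:
  assumes "vs_iso \<iota> r \<phi>" "x \<in> carrier_vec r"
  shows "mult_map \<phi> a (mult_map \<phi> b x) = mult_map \<phi> (a * b) x"
  using assms by (simp add: mult_map_def inv_vs_iso mult.assoc)

lemma mult_map_one: "vs_iso \<iota> r \<phi> \<Longrightarrow> x \<in> carrier_vec r \<Longrightarrow> mult_map \<phi> 1 x = x"
  by (simp add: mult_map_def vs_iso_inv)

lemma mult_map_funpow:
  assumes "vs_iso \<iota> r \<phi>"
  shows "(mult_map \<phi> b ^^ k) (\<phi> x) = \<phi> (b ^ k * x)"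
  by (induction k) (simp_all add: mult_map_apply[OF assms] mult.assoc)

text \<open>Through \<open>\<phi>\<close> the map is multiplication by \<open>b\<close>, which
  distributes over sums and commutes with the scalars \<open>\<iota> c\<close>.\<close>

lemma linear_mult_map:
  fixes \<phi> :: "'b::field \<Rightarrow> 'a::field vec"
  assumes \<phi>: "vs_iso \<iota> r \<phi>"
  shows "linear_vec_map r r (mult_map \<phi> b)"
  unfolding linear_vec_map_def
proof (intro conjI ballI allI funcsetI)
  fix x :: "'a vec" assume "x \<in> carrier_vec r"
  then obtain x' where x': "x = \<phi> x'" using \<phi> vs_iso_inv by metis
  show "mult_map \<phi> b x \<in> carrier_vec r"
    by (simp add: x' mult_map_apply[OF \<phi>] vs_iso_carrier[OF \<phi>])
  show "mult_map \<phi> b (c \<cdot>\<^sub>v x) = c \<cdot>\<^sub>v mult_map \<phi> b x" for c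
  proof -
    have sm: "c \<cdot>\<^sub>v \<phi> y = \<phi> (\<iota> c * y)" for y using \<phi> by (simp add: vs_iso_def)
    show ?thesis unfolding x' sm mult_map_apply[OF \<phi>] by (simp add: mult.left_commute)
  qed
  fix y :: "'a vec" assume "y \<in> carrier_vec r"
  then obtain y' where y': "y = \<phi> y'" using \<phi> vs_iso_inv by metis
  have add: "\<phi> z + \<phi> w = \<phi> (z + w)" for z w using \<phi> by (simp add: vs_iso_def)
  show "mult_map \<phi> b (x + y) = mult_map \<phi> b x + mult_map \<phi> b y"
    unfolding x' y' add mult_map_apply[OF \<phi>] by (simp add: distrib_left)
qed

lemma inj_on_mult_map:
  fixes \<phi> :: "'b::field \<Rightarrow> 'a::field vec"
  assumes \<phi>: "vs_iso \<iota> r \<phi>" and b: "b \<noteq> 0"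
  shows "inj_on (mult_map \<phi> b) (carrier_vec r)"
proof (rule inj_on_inverseI)
  fix x :: "'a vec" assume "x \<in> carrier_vec r"
  then show "mult_map \<phi> (inverse b) (mult_map \<phi> b x) = x"
    using b by (simp add: mult_map_mult[OF \<phi>] mult_map_one[OF \<phi>])
qed

section \<open>Cycle structure of multiplication by \<open>\<beta> ^ d\<close> on the
  representatives\<close>

theorem proposition46:
  fixes \<iota> :: "'a::{field,finite} \<Rightarrow> 'b::{field,finite}"
    and \<phi> :: "'b \<Rightarrow> 'a vec"
    and \<omega> \<beta> :: 'b
    and \<psi> :: "'a vec \<Rightarrow> 'a vec"
    and U :: "'a vec set"
    and q m k v n d :: nat
  assumes "q = CARD('a)"
    and "m \<ge> 1" and "1 \<le> k" and "k \<le> q - 1"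
    and "v = k + (m - 1) * (q - 1)"
    and "n = card (proj_space m :: 'a vec set set)"
    and "d = gcd n (q - 1)"
    and "CARD('b) = q ^ (m + 1)"
    and "field_hom \<iota>"
    and "vs_iso \<iota> (m + 1) \<phi>"
    and "primitive_element \<omega>"
    and "\<beta> = \<omega> ^ (q - 1)"
    and "\<psi> = mult_map \<phi> \<beta>"
    and "U = set (coord_list \<phi> \<omega> \<beta> n d)"
    and "coprime (n div d) (q - 1)"
  shows "quasi_cyclic_through U (weighted_code m v U (PLift m k)) d (perm_restrict (\<psi> ^^ d) U) \<and>
    orbit (perm_restrict (\<psi> ^^ d) U) ` U = (\<lambda>i. set (coord_block \<phi> \<omega> \<beta> n d i)) ` {0..<d}"
proof -
  note \<phi> = \<open>vs_iso \<iota> (m + 1) \<phi>\<close>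
  define l where "l = n div d"
  define N where "N = CARD('b) - 1"
  define blk where "blk = coord_block \<phi> \<omega> \<beta> n d"
  define css where "css = map blk [0..<d]"
  \<comment> \<open>The restriction is the identity off \<open>U\<close>, as a permutation of
    \<open>U\<close> and a product of cycles must be.\<close>
  define \<sigma> where "\<sigma> = perm_restrict (\<psi> ^^ d) U"
  have \<omega>: "\<omega> \<noteq> 0" using \<open>primitive_element \<omega>\<close> by (simp add: primitive_element_def)
  have \<beta>: "\<beta> \<noteq> 0" using \<omega> \<open>\<beta> = \<omega> ^ (q - 1)\<close> by simp
  have q: "q > 1"
  proof -
    have "card {0, 1 :: 'a} \<le> CARD('a)" by (rule card_mono) auto
    then show ?thesis using \<open>q = CARD('a)\<close> by simp
  qed
  have d_dvd: "d dvd n" and d: "d > 0"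
    using q \<open>d = gcd n (q - 1)\<close> by simp_all
  have n_eq: "n = d * l" using d_dvd by (simp add: l_def)
  have N_eq: "N = (q - 1) * d * l"
  proof -
    \<comment> \<open>The geometric factorization makes the division in the formula for
      \<open>n\<close> exact; it is carried out over the integers to avoid truncated
      subtraction.\<close>
    have "int q - 1 dvd int q ^ (m + 1) - 1"
      unfolding power_diff_1_eq by (rule dvd_triv_left)
    then have "int (q - 1) dvd int (q ^ (m + 1) - 1)"
      using q by (simp add: of_nat_diff)
    then have "(q - 1) dvd q ^ (m + 1) - 1" by (simp only: int_dvd_int_iff)
    moreover have "n = (q ^ (m + 1) - 1) div (q - 1)"
      unfolding \<open>n = card _\<close> \<open>q = _\<close> by (rule card_proj_space)
    ultimately have "q ^ (m + 1) - 1 = (q - 1) * n" by simp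
    then show ?thesis
      unfolding N_def \<open>CARD('b) = _\<close> by (simp add: n_eq mult.assoc)
  qed
  have N: "N > 0"
    using \<open>CARD('b) = q ^ (m + 1)\<close> one_less_power[OF q, of "m + 1"] by (simp add: N_def)
  have l: "l > 0" using N N_eq by (cases l) auto
  have powN: "\<omega> ^ N = 1" and injN: "inj_on ((^) \<omega>) {..<N}"
    using primitive_element_powers[OF \<open>primitive_element \<omega>\<close>] by (simp_all add: N_def)
  have \<beta>_pow: "\<beta> ^ (j * d) = \<omega> ^ ((q - 1) * d * j)" for j
    by (simp add: \<open>\<beta> = \<omega> ^ (q - 1)\<close> power_mult[symmetric] mult_ac)
  \<comment> \<open>This relation closes each block into a cycle of length \<open>l\<close>.\<close>
  have \<beta>_l: "\<beta> ^ (l * d) = 1"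
    using powN by (simp add: \<beta>_pow N_eq)
  have len: "length (blk i) = l" for i by (simp add: blk_def coord_block_def l_def)
  \<comment> \<open>Blocks are indexed from 1 but list positions start at 0, hence
    \<open>Suc j\<close>.\<close>
  have nth: "blk i ! j = \<phi> (\<omega> ^ i * \<beta> ^ (Suc j * d))" if "j < l" for i j
    using that by (simp add: blk_def coord_block_def l_def del: upt_Suc)
  have U: "U = (\<Union>i<d. set (blk i))"
    using \<open>U = _\<close> by (auto simp: coord_list_def blk_def)
  have nth_inj: "i = i' \<and> j = j'"
    if ij: "i < d" "j < l" "i' < d" "j' < l" and eq: "blk i ! j = blk i' ! j'" for i j i' j'
  proof -
    let ?D = "(q - 1) * d"
    \<comment> \<open>Since \<open>a < d \<le> ?D\<close>, the pair \<open>(a, b)\<close> consists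
      of remainder and quotient modulo \<open>?D\<close>, and the exponent stays below
      \<open>?D * l = N\<close>.\<close>
    have bound: "a + ?D * b < N" and less: "a < ?D" if "a < d" "b < l" for a b
    proof -
      have "1 * d \<le> ?D" using q by (intro mult_le_mono1) simp
      with that show "a < ?D" by linarith
      then have "a + ?D * b < ?D * Suc b" by simp
      also have "\<dots> \<le> ?D * l" using that by (intro mult_le_mono2) simp
      finally show "a + ?D * b < N" by (simp add: N_eq)
    qed
    \<comment> \<open>Removing the common factor \<open>\<beta> ^ d\<close> undoes the index shift
      and brings the exponents into the range where powers of \<open>\<omega>\<close> are
      distinct.\<close>
    have split: "\<omega> ^ a * \<beta> ^ (Suc b * d) = \<beta> ^ d * \<omega> ^ (a + ?D * b)" for a b
      unfolding mult_Suc power_add \<beta>_pow by (rule mult.left_commute)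
    have "\<omega> ^ i * \<beta> ^ (Suc j * d) = \<omega> ^ i' * \<beta> ^ (Suc j' * d)"
      using eq ij by (metis inv_vs_iso[OF \<phi>] nth)
    then have "\<beta> ^ d * \<omega> ^ (i + ?D * j) = \<beta> ^ d * \<omega> ^ (i' + ?D * j')"
      unfolding split .
    then have "\<omega> ^ (i + ?D * j) = \<omega> ^ (i' + ?D * j')" using \<beta> by simp
    then have e: "i + ?D * j = i' + ?D * j'"
      by (rule inj_onD[OF injN]) (use bound ij in auto)
    have "i = (i + ?D * j) mod ?D" using less ij by simp
    also have "\<dots> = i'" unfolding e using less ij by simp
    finally show ?thesis using e q d by simp
  qed
  have dist: "distinct (blk i)" if "i < d" for i
    unfolding distinct_conv_nth len using nth_inj[OF that _ that] by blast
  have disj: "set (blk i) \<inter> set (blk i') = {}" if "i < d" "i' < d" "i \<noteq> i'" for i i'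
  proof (rule equals0I)
    fix x assume "x \<in> set (blk i) \<inter> set (blk i')"
    then obtain j j' where "j < l" "j' < l" "blk i ! j = x" "blk i' ! j' = x"
      by (auto simp: in_set_conv_nth len)
    then show False using nth_inj[of i j i' j'] that by simp
  qed
  have cardU: "card U = n"
  proof -
    have "card U = (\<Sum>i<d. card (set (blk i)))"
      unfolding U by (rule card_UN_disjoint) (use disj in auto)
    also have "\<dots> = d * l" by (simp add: distinct_card dist len)
    finally show ?thesis by (simp add: n_eq)
  qed
  have U_form: "\<exists>z. z \<noteq> 0 \<and> u = \<phi> z" if u: "u \<in> U" for u
  proof -
    from u obtain i j where "j < l" "u = blk i ! j" unfolding U by (auto simp: in_set_conv_nth len)
    then show ?thesis using nth \<omega> \<beta> by (intro exI[of _ "\<omega> ^ i * \<beta> ^ (Suc j * d)"]) simp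
  qed
  have U_sub: "U \<subseteq> carrier_vec (m + 1) - {0\<^sub>v (m + 1)}"
  proof
    fix u assume "u \<in> U"
    from U_form[OF this] obtain z where "z \<noteq> 0" "u = \<phi> z" by blast
    then show "u \<in> carrier_vec (m + 1) - {0\<^sub>v (m + 1)}"
      using vs_iso_carrier[OF \<phi>, of z] vs_iso_nonzero[OF \<phi>, of z] by simp
  qed
  have \<sigma>_U: "\<sigma> (\<phi> z) = \<phi> (\<beta> ^ d * z)" if "\<phi> z \<in> U" for z
    using that by (simp add: \<sigma>_def perm_restrict_def \<open>\<psi> = _\<close> mult_map_funpow[OF \<phi>])
  have shift: "\<sigma> (blk i ! j) = blk i ! (Suc j mod l)" if "i < d" "j < l" for i j
  proof -
    have "blk i ! j \<in> U" unfolding U using that by (auto simp: in_set_conv_nth len)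
    then have *: "\<sigma> (blk i ! j) = \<phi> (\<beta> ^ d * (\<omega> ^ i * \<beta> ^ (Suc j * d)))"
      using \<sigma>_U nth[OF that(2)] by simp
    show ?thesis
    \<comment> \<open>At the last position \<open>\<beta> ^ (l * d) = 1\<close>, so multiplication
      by \<open>\<beta> ^ d\<close> leads back to the first entry.\<close>
    proof (cases "Suc j = l")
      case True
      then show ?thesis unfolding * True mod_self nth[OF l] \<beta>_l by (simp add: mult.commute)
    next
      case False
      then show ?thesis unfolding * using that by (simp add: nth power_add mult_ac)
    qed
  qed
  have css: "length css = d" "\<And>i. i < d \<Longrightarrow> css ! i = blk i" "set css = blk ` {..<d}"
    by (auto simp: css_def)
  have \<sigma>_foldr: "\<sigma> = foldr (\<circ>) (map cycle_of_list css) id"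
  proof (rule eq_foldr_cycles)
    fix x assume "\<And>cs. cs \<in> set css \<Longrightarrow> x \<notin> set cs"
    then have "x \<notin> U" by (auto simp: css U)
    then show "\<sigma> x = x" by (simp add: \<sigma>_def perm_restrict_def)
  qed (use dist disj shift in \<open>auto simp: css len\<close>)
  have \<sigma>_perm: "\<sigma> permutes U"
    unfolding \<sigma>_foldr by (rule foldr_cycles_permutes) (auto simp: css U)
  have "perm_act U \<sigma> ` weighted_code m v U (PLift m k) = weighted_code m v U (PLift m k)"
  proof (rule perm_act_weighted_PLift[OF _ U_sub])
    show "v = k + (m - 1) * (CARD('a) - 1)"
      using \<open>v = _\<close> \<open>q = CARD('a)\<close> by simp
    show "linear_vec_map (m + 1) (m + 1) (mult_map \<phi> (\<beta> ^ d))"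
      "linear_vec_map (m + 1) (m + 1) (mult_map \<phi> (inverse (\<beta> ^ d)))"
      by (rule linear_mult_map[OF \<phi>])+
    show "inj_on (mult_map \<phi> (\<beta> ^ d)) (carrier_vec (m + 1))"
      "inj_on (mult_map \<phi> (inverse (\<beta> ^ d))) (carrier_vec (m + 1))"
      by (rule inj_on_mult_map[OF \<phi>], use \<beta> in simp)+
    show "mult_map \<phi> (\<beta> ^ d) (mult_map \<phi> (inverse (\<beta> ^ d)) x) = x"
      if "x \<in> carrier_vec (m + 1)" for x
      using that \<beta> by (simp add: mult_map_mult[OF \<phi>] mult_map_one[OF \<phi>])
    show "\<sigma> x = mult_map \<phi> (\<beta> ^ d) x" if "x \<in> U" for x
      using that U_form[OF that] \<sigma>_U by (auto simp: mult_map_apply[OF \<phi>])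
  qed (rule \<sigma>_perm)
  then have "\<sigma> \<in> Perm_code U (weighted_code m v U (PLift m k))"
    using \<sigma>_perm by (simp add: Perm_code_def)
  then have "quasi_cyclic_through U (weighted_code m v U (PLift m k)) d \<sigma>"
    unfolding quasi_cyclic_through_def cardU
    using d_dvd dist disj \<sigma>_foldr
    by (intro conjI exI[of _ css]) (auto simp: css len U l_def[symmetric])
  moreover have "orbit \<sigma> ` U = (\<lambda>i. set (blk i)) ` {0..<d}"
  proof -
    have orb: "orbit \<sigma> x = set (blk i)" if "i < d" "x \<in> set (blk i)" for i x
      by (rule orbit_of_cyclic_shift) (use that shift in \<open>auto simp: len\<close>)
    \<comment> \<open>Each block is nonempty because \<open>l > 0\<close>, so it is the orbit of its
      first entry.\<close>
    have "set (blk i) \<in> orbit \<sigma> ` U" if i: "i < d" for i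
    proof -
      have x: "blk i ! 0 \<in> set (blk i)" using l by (simp add: len)
      then show ?thesis using orb[OF i x] i unfolding U by blast
    qed
    moreover have "orbit \<sigma> x \<in> (\<lambda>i. set (blk i)) ` {0..<d}" if "x \<in> U" for x
      using that orb unfolding U by auto
    ultimately show ?thesis by auto
  qed
  ultimately show ?thesis by (simp add: \<sigma>_def blk_def)
qed

end
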